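(* Let $n=2m$ be an even positive integer, let $M_n:=\max_{0\leq k\leq n} S_k$ be the maximum up to time $n$ of the simple symmetric random walk $(S_k)_{k\ge 0}$, and let $W:=M_n/\sqrt{n}$. Let $Y:=|Z|$, where $Z$ is a standard normal random variable. Then $$d_{\mathcal{W}}(W,Y)\leq\frac{1}{\sqrt{n}}\Bigl(3+\frac{2}{\pi}\Bigr)$$ and $$d_{\mathcal{K}}(W,Y)\leq\frac{1}{\sqrt{n}}\Bigl(4\sqrt{\frac{2}{\pi}}+\frac{1}{2}\Bigr)+\frac{2}{n}.$$
   Context: The simple symmetric random walk is $S_0:=0$, $S_k:=\sum_{j=1}^k X_j$ for $k\geq 1$, where $X_1,X_2,\dots$ are i.i.d. with $P(X_1=1)=P(X_1=-1)=1/2$. For real random variables $U,V$ with finite first moments, the Wasserstein distance is $d_{\mathcal{W}}(U,V):=\sup_{h}|E[h(U)]-E[h(V)]|$, where the supremum is over all functions $h:\mathbb{R}\to\mathbb{R}$ that are Lipschitz continuous with Lipschitz constant at most $1$. The Kolmogorov distance is $d_{\mathcal{K}}(U,V):=\sup_{z\in\mathbb{R}}|P(U\leq z)-P(V\leq z)|$. Both depend only on the distributions of $U$ and $V$. *)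

theory Defs
  imports "HOL-Probability.Probability"
begin

text \<open>
  Both distances take the two random variables together with the measure spaces on which they are
  defined, as these need not coincide. The suprema are taken in the extended reals, so that they
  exist unconditionally. The Wasserstein distance is meaningful only for integrable \<open>U\<close>
  and \<open>V\<close>, since the Bochner integral of a non-integrable function is \<open>0\<close>.
\<close>

definition wasserstein_dist ::
    "'a measure \<Rightarrow> ('a \<Rightarrow> real) \<Rightarrow> 'b measure \<Rightarrow> ('b \<Rightarrow> real) \<Rightarrow> ereal" where
  "wasserstein_dist M U N V =
     (SUP h \<in> {h :: real \<Rightarrow> real. 1-lipschitz_on UNIV h}.
        ereal \<bar>(\<integral>x. h (U x) \<partial>M) - (\<integral>y. h (V y) \<partial>N)\<bar>)"

definition kolmogorov_dist ::
    "'a measure \<Rightarrow> ('a \<Rightarrow> real) \<Rightarrow> 'b measure \<Rightarrow> ('b \<Rightarrow> real) \<Rightarrow> ereal" where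
  "kolmogorov_dist M U N V =
     (SUP z :: real. ereal \<bar>\<P>(x in M. U x \<le> z) - \<P>(y in N. V y \<le> z)\<bar>)"

text \<open>The steps are indexed from \<open>1\<close>; \<open>X 0\<close> is irrelevant.\<close>

definition symmetric_steps :: "'a measure \<Rightarrow> (nat \<Rightarrow> 'a \<Rightarrow> real) \<Rightarrow> bool" where
  "symmetric_steps M X \<longleftrightarrow>
     prob_space.indep_vars M (\<lambda>_. borel) X {1..} \<and>
     (\<forall>j\<ge>1. distr M borel (X j) = distr M borel (X 1)) \<and>
     \<P>(\<omega> in M. X 1 \<omega> = 1) = 1 / 2 \<and>
     \<P>(\<omega> in M. X 1 \<omega> = - 1) = 1 / 2"

definition walk :: "(nat \<Rightarrow> 'a \<Rightarrow> real) \<Rightarrow> nat \<Rightarrow> 'a \<Rightarrow> real" where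
  "walk X k \<omega> = (\<Sum>j=1..k. X j \<omega>)"

definition walk_max :: "(nat \<Rightarrow> 'a \<Rightarrow> real) \<Rightarrow> nat \<Rightarrow> 'a \<Rightarrow> real" where
  "walk_max X n \<omega> = Max ((\<lambda>k. walk X k \<omega>) ` {0..n})"

end

theory Submission
  imports Defs
begin

text \<open>
  The law of the maximum is that of a folded walk: decomposing at the first step, the maximum evolves by
  \<open>r \<mapsto> max 0 (r \<plusminus> 1)\<close> with fair signs, and so does \<open>\<bar>S\<^sub>n + 1/2\<bar> - 1/2\<close>. Hence the two have the same law
  (\<open>expectation_walk_max\<close>), which differs from \<open>\<bar>S\<^sub>n\<bar>\<close> by at most \<open>1\<close>, or \<open>\<sigma> = 1/\<surd>n\<close> after rescaling. It
  remains to compare \<open>S\<^sub>n/\<surd>n\<close> with a standard normal variable \<open>Z\<close> on test functions of the absolute value.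

  This is done by Stein's method. For a test function \<open>h\<close> let \<open>f\<close> solve
  \<open>f'(x) - x f(x) = h(x) - E[h(Z)]\<close>. The walk satisfies the exact identity
  \<open>E[S\<^sub>n g(S\<^sub>n)] = n E[(g(S\<^bsub>n-1\<^esub> + 1) - g(S\<^bsub>n-1\<^esub> - 1))/2]\<close>, a discrete form of the
  characterisation \<open>E[Z f(Z)] = E[f'(Z)]\<close>. Writing the difference as an integral of \<open>f'\<close> and moving
  the integrand to the endpoints of the lattice steps yields
  \<open>E[h(S\<^sub>n/\<surd>n)] - E[h(Z)] \<le> (A + B + L) \<sigma>/2\<close> when \<open>\<bar>f'\<bar> \<le> A\<close>, \<open>\<bar>f\<bar> \<le> B\<close>, and \<open>h\<close> is \<open>L\<close>-Lipschitz
  (\<open>srw_mean_le_stein\<close>). Only \<open>f\<close> and \<open>f'\<close> enter, no second derivative, so the same lemma serves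
  indicators of intervals, where \<open>L = 0\<close> and the interval is enlarged or shrunk by one lattice step.

  For 1-Lipschitz \<open>h\<close>, Mills ratio estimates give \<open>A = 1 + \<surd>(2/\<pi>)\<close> and \<open>B = 2\<close>. With the folding error
  \<open>\<sigma>\<close> the Wasserstein distance is at most \<open>(3 + \<surd>(2/\<pi>)/2) \<sigma>\<close>, and \<open>\<surd>(2/\<pi>)/2 \<le> 2/\<pi>\<close>. For indicators,
  \<open>A = 2\<close> and \<open>B = \<surd>(\<pi>/2)\<close>; enlarging the interval \<open>[-z, z]\<close> by \<open>2\<sigma>\<close> costs at most \<open>2 \<surd>(2/\<pi>) \<sigma>\<close>. The
  resulting constant \<open>2 \<surd>(2/\<pi>) + 1 + \<surd>(\<pi>/2)/2\<close> is below \<open>4 \<surd>(2/\<pi>) + 1/2\<close>.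
\<close>

section \<open>A Stein bound for the simple random walk\<close>

text \<open>
  The expectation of \<open>g\<close> at the position of the walk after \<open>n\<close> steps, as a functional of
  integer-valued functions. Written recursively, it makes both the Stein identity and the law of the
  maximum plain inductions, with no binomial coefficients.
\<close>

fun srw_mean :: "nat \<Rightarrow> (int \<Rightarrow> real) \<Rightarrow> real" where
  "srw_mean 0 g = g 0"
| "srw_mean (Suc n) g = (srw_mean n (\<lambda>s. g (s + 1)) + srw_mean n (\<lambda>s. g (s - 1))) / 2"

lemma srw_mean_mono: "(\<And>s. g s \<le> h s) \<Longrightarrow> srw_mean n g \<le> srw_mean n h"
proof (induction n arbitrary: g h)
  case (Suc n)
  have "srw_mean n (\<lambda>s. g (s + 1)) \<le> srw_mean n (\<lambda>s. h (s + 1))"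
    and "srw_mean n (\<lambda>s. g (s - 1)) \<le> srw_mean n (\<lambda>s. h (s - 1))"
    by (rule Suc.IH, rule Suc.prems)+
  then show ?case by simp
qed simp

lemma srw_mean_add: "srw_mean n (\<lambda>s. g s + h s) = srw_mean n g + srw_mean n h"
  by (induction n arbitrary: g h) (simp_all add: add_divide_distrib)

lemma srw_mean_cmult: "srw_mean n (\<lambda>s. c * g s) = c * srw_mean n g"
  by (induction n arbitrary: g) (simp_all add: algebra_simps)

lemma srw_mean_diff: "srw_mean n (\<lambda>s. g s - h s) = srw_mean n g - srw_mean n h"
  by (induction n arbitrary: g h) (simp_all add: diff_divide_distrib add_divide_distrib)

lemma srw_mean_const: "srw_mean n (\<lambda>s. c) = c"
  by (induction n) simp_all

text \<open>
  Exchangeability gives \<open>E[S\<^sub>n f(S\<^sub>n)] = n E[X\<^sub>n f(S\<^sub>n)]\<close>, and averaging over the last step turns the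
  right side into a central difference of \<open>f\<close> at \<open>S\<^bsub>n-1\<^esub>\<close>. In the induction, a step of the walk
  splits \<open>s \<plusminus> 1\<close> into \<open>s\<close>, where the hypothesis applies to the symmetric mean of \<open>f\<close>, and \<open>\<plusminus> 1\<close>,
  which contributes one more difference.
\<close>

lemma srw_mean_stein_identity:
  "srw_mean (Suc n) (\<lambda>s. of_int s * f s) = real (Suc n) * srw_mean n (\<lambda>s. (f (s + 1) - f (s - 1)) / 2)"
proof (induction n arbitrary: f)
  case (Suc n)
  let ?D = "\<lambda>s. (f (s + 1) - f (s - 1)) / 2"
  have "srw_mean (Suc (Suc n)) (\<lambda>s. of_int s * f s)
      = (srw_mean (Suc n) (\<lambda>s. of_int (s + 1) * f (s + 1)) + srw_mean (Suc n) (\<lambda>s. of_int (s - 1) * f (s - 1))) / 2"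
    by (rule srw_mean.simps)
  also have "\<dots> = srw_mean (Suc n) (\<lambda>s. (1/2) * (of_int (s + 1) * f (s + 1) + of_int (s - 1) * f (s - 1)))"
    by (simp only: srw_mean_add srw_mean_cmult)
  also have "(\<lambda>s. (1/2) * (of_int (s + 1) * f (s + 1) + of_int (s - 1) * f (s - 1)))
      = (\<lambda>s. of_int s * ((f (s + 1) + f (s - 1)) / 2) + ?D s)"
    by (simp add: fun_eq_iff field_simps)
  also have "srw_mean (Suc n) \<dots> = srw_mean (Suc n) (\<lambda>s. of_int s * ((f (s + 1) + f (s - 1)) / 2))
      + srw_mean (Suc n) ?D"
    by (rule srw_mean_add)
  also have "srw_mean (Suc n) (\<lambda>s. of_int s * ((f (s + 1) + f (s - 1)) / 2))
     = real (Suc n) * srw_mean n (\<lambda>s. ((f (s + 1 + 1) + f (s + 1 - 1)) / 2 - (f (s - 1 + 1) + f (s - 1 - 1)) / 2) / 2)"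
    by (rule Suc.IH)
  also have "(\<lambda>s. ((f (s + 1 + 1) + f (s + 1 - 1)) / 2 - (f (s - 1 + 1) + f (s - 1 - 1)) / 2) / 2)
     = (\<lambda>s. (1/2) * (?D (s + 1) + ?D (s - 1)))"
    by (simp add: fun_eq_iff field_simps)
  also have "srw_mean n \<dots> = srw_mean (Suc n) ?D"
    by (simp only: srw_mean_add srw_mean_cmult srw_mean.simps)
  finally show ?case
    by (simp only: of_nat_Suc[of "Suc n"] distrib_right mult_1_left add.commute)
qed simp

lemma srw_mean_square: "srw_mean n (\<lambda>s. (of_int s)\<^sup>2) = real n"
proof (cases n)
  case (Suc k)
  show ?thesis
    unfolding Suc power2_eq_square
    by (subst srw_mean_stein_identity) (simp add: srw_mean_const del: srw_mean.simps)
qed simp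

text \<open>
  Cauchy--Schwarz against the variance \<open>n\<close>, in the pointwise form
  \<open>\<bar>s\<bar> \<le> (s\<^sup>2/\<surd>n + \<surd>n)/2\<close>, which needs only monotonicity and linearity.
\<close>

lemma srw_mean_abs_le: "srw_mean n (\<lambda>s. \<bar>of_int s\<bar>) \<le> sqrt (real n)"
proof (cases "n = 0")
  case False
  let ?r = "sqrt (real n)"
  have r: "?r > 0" using False by simp
  have "\<bar>x\<bar> \<le> 1 / (2 * ?r) * x\<^sup>2 + ?r / 2" for x :: real
  proof -
    have "2 * ?r * \<bar>x\<bar> \<le> x\<^sup>2 + ?r\<^sup>2"
      using sum_squares_bound[of ?r "\<bar>x\<bar>"] by simp
    then show ?thesis using r by (simp add: field_simps power2_eq_square del: real_sqrt_mult_self real_sqrt_pow2)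
  qed
  then have "srw_mean n (\<lambda>s. \<bar>of_int s\<bar>) \<le> srw_mean n (\<lambda>s. 1 / (2 * ?r) * (of_int s)\<^sup>2 + ?r / 2)"
    by (intro srw_mean_mono)
  also have "\<dots> = 1 / (2 * ?r) * real n + ?r / 2"
    by (simp only: srw_mean_add srw_mean_cmult srw_mean_const srw_mean_square)
  also have "\<dots> = ?r" using r
    by (simp add: field_simps power2_eq_square)
  finally show ?thesis .
qed simp

lemma has_integral_affine:
  fixes p k :: real
  assumes "a \<le> b"
  shows "((\<lambda>t. p + k * t) has_integral p * (b - a) + k * (b\<^sup>2 - a\<^sup>2) / 2) {a..b}"
proof -
  have "((\<lambda>t. p + k * t) has_integral (p * b + k * b\<^sup>2 / 2) - (p * a + k * a\<^sup>2 / 2)) {a..b}"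
    using assms by (intro fundamental_theorem_of_calculus)
      (auto simp flip: has_real_derivative_iff_has_vector_derivative intro!: derivative_eq_intros)
  then show ?thesis by (simp add: algebra_simps diff_divide_distrib)
qed

text \<open>
  Over a lattice step the increment of \<open>f\<close> is the integral of \<open>t f(t) + h(t) - c\<close>. Freezing the
  integrand at the endpoint \<open>x\<close>, where the walk sits, costs at most \<open>(A \<bar>x\<bar> + B + L) \<bar>x - t\<bar>\<close>: the
  bound \<open>A\<close> on \<open>f'\<close> is also a Lipschitz constant of \<open>f\<close>, and
  \<open>x f(x) - t f(t) = x (f(x) - f(t)) + (x - t) f(t)\<close>. The distance \<open>\<bar>x - t\<bar>\<close> has mean \<open>\<sigma>/2\<close> over the
  step. The value \<open>H\<close> stands for the test function at the lattice point and is decoupled from \<open>h x\<close>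
  so that a discontinuous \<open>h\<close> can be replaced by a smaller one.
\<close>

lemma stein_increment_bound:
  fixes f h :: "real \<Rightarrow> real"
  assumes D: "\<And>a b. a \<le> b \<Longrightarrow> ((\<lambda>t. t * f t + h t - c) has_integral (f b - f a)) {a..b}"
    and A: "\<And>t. \<bar>t * f t + h t - c\<bar> \<le> A" and B: "\<And>t. \<bar>f t\<bar> \<le> B"
    and \<sigma>: "\<sigma> \<ge> 0" and H: "\<And>t. \<bar>x - t\<bar> \<le> \<sigma> \<Longrightarrow> H \<le> h t + L * \<bar>x - t\<bar>"
  shows "\<sigma> * (x * f x + H - c - (A * \<bar>x\<bar> + B + L) * \<sigma> / 2) \<le> f x - f (x - \<sigma>)"
    and "\<sigma> * (x * f x + H - c - (A * \<bar>x\<bar> + B + L) * \<sigma> / 2) \<le> f (x + \<sigma>) - f x"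
proof -
  define K where "K = A * \<bar>x\<bar> + B + L"
  have lip: "\<bar>f b - f a\<bar> \<le> A * \<bar>b - a\<bar>" for a b
  proof -
    have *: "\<bar>f b - f a\<bar> \<le> A * (b - a)" if "a \<le> b" for a b
      using has_integral_bound[of A "\<lambda>t. t * f t + h t - c" "f b - f a" a b] D[OF that] A that
        order_trans[OF abs_ge_zero A[of 0]]
      by simp
    show ?thesis using *[of a b] *[of b a] by (cases "a \<le> b") (auto simp: abs_minus_commute)
  qed
  have pt: "x * f x + H - c - K * \<bar>x - t\<bar> \<le> t * f t + h t - c" if "\<bar>x - t\<bar> \<le> \<sigma>" for t
  proof -
    have "x * f x - t * f t = x * (f x - f t) + (x - t) * f t" by (simp add: algebra_simps)
    also have "\<dots> \<le> \<bar>x\<bar> * \<bar>f x - f t\<bar> + \<bar>x - t\<bar> * \<bar>f t\<bar>"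
      unfolding abs_mult[symmetric] by linarith
    also have "\<dots> \<le> \<bar>x\<bar> * (A * \<bar>x - t\<bar>) + \<bar>x - t\<bar> * B"
      by (intro add_mono mult_left_mono lip B) auto
    finally show ?thesis using H[OF that] by (simp add: K_def algebra_simps)
  qed
  define p where "p = x * f x + H - c"
  have int: "((\<lambda>t. (p - K * x) + K * t) has_integral (p - K * x) * (x - (x - \<sigma>)) + K * (x\<^sup>2 - (x - \<sigma>)\<^sup>2) / 2) {x - \<sigma>..x}"
    using \<sigma> by (intro has_integral_affine) auto
  have le: "(p - K * x) + K * t \<le> t * f t + h t - c" if "t \<in> {x - \<sigma>..x}" for t
    using pt[of t] that by (simp add: p_def algebra_simps)
  have "(p - K * x) * (x - (x - \<sigma>)) + K * (x\<^sup>2 - (x - \<sigma>)\<^sup>2) / 2 \<le> f x - f (x - \<sigma>)"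
    by (rule has_integral_le[OF int D le]) (use \<sigma> in auto)
  also have "(p - K * x) * (x - (x - \<sigma>)) + K * (x\<^sup>2 - (x - \<sigma>)\<^sup>2) / 2 = \<sigma> * (p - K * \<sigma> / 2)"
    by (simp add: power2_eq_square field_simps)
  finally show "\<sigma> * (x * f x + H - c - (A * \<bar>x\<bar> + B + L) * \<sigma> / 2) \<le> f x - f (x - \<sigma>)"
    unfolding p_def K_def .
  have int: "((\<lambda>t. (p + K * x) + (- K) * t) has_integral (p + K * x) * ((x + \<sigma>) - x) + (- K) * ((x + \<sigma>)\<^sup>2 - x\<^sup>2) / 2) {x..x + \<sigma>}"
    using \<sigma> by (intro has_integral_affine) auto
  have le: "(p + K * x) + (- K) * t \<le> t * f t + h t - c" if "t \<in> {x..x + \<sigma>}" for t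
    using pt[of t] that by (simp add: p_def algebra_simps)
  have "(p + K * x) * ((x + \<sigma>) - x) + (- K) * ((x + \<sigma>)\<^sup>2 - x\<^sup>2) / 2 \<le> f (x + \<sigma>) - f x"
    by (rule has_integral_le[OF int D le]) (use \<sigma> in auto)
  also have "(p + K * x) * ((x + \<sigma>) - x) + (- K) * ((x + \<sigma>)\<^sup>2 - x\<^sup>2) / 2 = \<sigma> * (p - K * \<sigma> / 2)"
    by (simp add: power2_eq_square field_simps)
  finally show "\<sigma> * (x * f x + H - c - (A * \<bar>x\<bar> + B + L) * \<sigma> / 2) \<le> f (x + \<sigma>) - f x"
    unfolding p_def K_def .
qed

text \<open>
  Stein's method for the rescaled walk \<open>S\<^sub>n/\<surd>n\<close>. The identity for the walk says that the mean of
  \<open>x f(x)\<close> equals the mean central difference quotient of \<open>f\<close>, which by the differential equation is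
  almost the mean of \<open>x f(x) + h(x) - c\<close>; what is left over is \<open>E[h] - c\<close>, bounded by the cost of
  freezing the integrand. Any bounded solution \<open>f\<close> with bounded derivative will do, and its equation
  is needed only in integrated form, so \<open>h\<close> may have jumps.
\<close>

lemma srw_mean_le_stein:
  fixes f h :: "real \<Rightarrow> real"
  assumes n: "n > 0" and \<sigma>: "\<sigma> = 1 / sqrt (real n)"
    and D: "\<And>a b. a \<le> b \<Longrightarrow> ((\<lambda>t. t * f t + h t - c) has_integral (f b - f a)) {a..b}"
    and A: "\<And>t. \<bar>t * f t + h t - c\<bar> \<le> A" and B: "\<And>t. \<bar>f t\<bar> \<le> B"
    and H: "\<And>s t. \<bar>of_int s * \<sigma> - t\<bar> \<le> \<sigma> \<Longrightarrow> H s \<le> h t + L * \<bar>of_int s * \<sigma> - t\<bar>"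
  shows "srw_mean n H \<le> c + (A + B + L) * \<sigma> / 2"
proof -
  obtain k where k: "n = Suc k" using n by (cases n) auto
  have \<sigma>0: "\<sigma> > 0" and \<sigma>n: "real n * \<sigma>\<^sup>2 = 1" using n by (auto simp: \<sigma> power_divide)
  define x where "x = (\<lambda>s::int. of_int s * \<sigma>)"
  define \<Psi> where "\<Psi> = (\<lambda>s. x s * f (x s) + H s - c - (A * \<bar>x s\<bar> + B + L) * \<sigma> / 2)"
  have x: "x (s + 1) = x s + \<sigma>" "x (s - 1) = x s - \<sigma>" for s
    by (simp_all add: x_def algebra_simps)
  have "\<sigma> * \<Psi> (s + 1) + \<sigma> * \<Psi> (s - 1) \<le> f (x (s + 1)) - f (x (s - 1))" for s
  proof -
    have "\<sigma> * \<Psi> (s + 1) \<le> f (x (s + 1)) - f (x (s + 1) - \<sigma>)"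
      unfolding \<Psi>_def by (rule stein_increment_bound(1)[where h = h])
        (use D A B H[of "s + 1"] \<sigma>0 in \<open>auto simp: x_def\<close>)
    moreover have "\<sigma> * \<Psi> (s - 1) \<le> f (x (s - 1) + \<sigma>) - f (x (s - 1))"
      unfolding \<Psi>_def by (rule stein_increment_bound(2)[where h = h])
        (use D A B H[of "s - 1"] \<sigma>0 in \<open>auto simp: x_def\<close>)
    ultimately show ?thesis by (simp add: x)
  qed
  then have "srw_mean k (\<lambda>s. \<sigma> / 2 * (\<Psi> (s + 1) + \<Psi> (s - 1))) \<le> srw_mean k (\<lambda>s. (f (x (s + 1)) - f (x (s - 1))) / 2)"
    by (intro srw_mean_mono) (simp add: algebra_simps)
  then have "\<sigma> * srw_mean n \<Psi> \<le> srw_mean k (\<lambda>s. (f (x (s + 1)) - f (x (s - 1))) / 2)"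
    by (simp only: k srw_mean_cmult srw_mean_add srw_mean.simps)
  then have "\<sigma> * (real n * \<sigma> * srw_mean n \<Psi>) \<le> \<sigma> * srw_mean n (\<lambda>s. of_int s * f (x s))"
    unfolding k using \<sigma>0
    by (subst srw_mean_stein_identity) (simp add: mult_left_mono mult.assoc mult.left_commute del: srw_mean.simps of_nat_Suc)
  also have "\<dots> = srw_mean n (\<lambda>s. x s * f (x s))"
    unfolding srw_mean_cmult[symmetric] by (simp add: x_def mult_ac)
  finally have le: "\<sigma> * (real n * \<sigma> * srw_mean n \<Psi>) \<le> srw_mean n (\<lambda>s. x s * f (x s))" .
  have "srw_mean n \<Psi> \<le> srw_mean n (\<lambda>s. x s * f (x s))"
  proof -
    have "\<sigma> * (real n * \<sigma> * y) = (real n * \<sigma>\<^sup>2) * y" for y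
      by (simp add: power2_eq_square)
    with le show ?thesis by (simp only: \<sigma>n mult_1)
  qed
  then have "0 \<le> srw_mean n (\<lambda>s. x s * f (x s)) - srw_mean n \<Psi>" by simp
  also have "\<dots> = srw_mean n (\<lambda>s. x s * f (x s) - \<Psi> s)" by (rule srw_mean_diff[symmetric])
  also have "(\<lambda>s. x s * f (x s) - \<Psi> s) = (\<lambda>s. (c + (B + L) * \<sigma> / 2) + (A * \<sigma>\<^sup>2 / 2) * \<bar>of_int s\<bar> - H s)"
    using \<sigma>0 by (auto simp: fun_eq_iff \<Psi>_def x_def abs_mult field_simps power2_eq_square)
  also have "srw_mean n \<dots> = c + (B + L) * \<sigma> / 2 + (A * \<sigma>\<^sup>2 / 2) * srw_mean n (\<lambda>s. \<bar>of_int s\<bar>) - srw_mean n H"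
    by (simp only: srw_mean_diff srw_mean_add srw_mean_cmult srw_mean_const)
  also have "(A * \<sigma>\<^sup>2 / 2) * srw_mean n (\<lambda>s. \<bar>of_int s\<bar>) \<le> (A * \<sigma>\<^sup>2 / 2) * sqrt (real n)"
    using order_trans[OF abs_ge_zero A[of 0]] by (intro mult_left_mono srw_mean_abs_le) auto
  also have "\<dots> = A * \<sigma> / 2"
    using n by (simp add: \<sigma> field_simps power2_eq_square)
  finally show ?thesis by (simp add: field_simps)
qed

section \<open>The law of the maximum\<close>

text \<open>
  The map \<open>s \<mapsto> \<bar>s + 1/2\<bar> - 1/2\<close>, which folds the integers at \<open>-1/2\<close>: it preserves neighbours, except
  that \<open>-1\<close> and \<open>0\<close> are both sent to \<open>0\<close>.
\<close>

definition fold_mirror :: "int \<Rightarrow> int" where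
  "fold_mirror s = (if s \<ge> 0 then s else - s - 1)"

text \<open>
  Folding turns a simple random walk into a walk on the nonnegative integers that stays put when it
  tries to step below \<open>0\<close>: as multisets, the images of the neighbours \<open>s \<plusminus> 1\<close> are
  \<open>max 0 (r \<plusminus> 1)\<close>, where \<open>r\<close> is the image of \<open>s\<close>. This carries the reflection principle.
\<close>

lemma fold_mirror_step:
  fixes g :: "real \<Rightarrow> real"
  shows "g (of_int (fold_mirror (s + 1))) + g (of_int (fold_mirror (s - 1)))
    = g (max 0 (1 + of_int (fold_mirror s))) + g (max 0 (- 1 + of_int (fold_mirror s)))"
proof -
  consider "s \<ge> 1" | "s = 0" | "s = -1" | "s \<le> -2" by linarith
  then show ?thesis
    by cases (auto simp: fold_mirror_def max_def algebra_simps)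
qed

lemma walk_Suc_shift: "walk X (Suc k) \<omega> = X 1 \<omega> + walk (\<lambda>j. X (Suc j)) k \<omega>"
  unfolding walk_def by (induction k) (simp_all add: ac_simps)

text \<open>
  Decomposition at the first step: seen from \<open>X 1\<close>, the later positions form a fresh walk. Its
  maximum therefore obeys the same dynamics as the folded walk.
\<close>

lemma walk_max_Suc_shift:
  "walk_max X (Suc n) \<omega> = max 0 (X 1 \<omega> + walk_max (\<lambda>j. X (Suc j)) n \<omega>)"
proof -
  have "(\<lambda>k. walk X k \<omega>) ` {0..Suc n} = insert (walk X 0 \<omega>) ((\<lambda>k. walk X (Suc k) \<omega>) ` {0..n})"
    unfolding atLeast0_atMost_Suc_eq_insert_0 image_insert image_image ..
  also have "\<dots> = insert 0 ((\<lambda>k. X 1 \<omega> + walk (\<lambda>j. X (Suc j)) k \<omega>) ` {0..n})"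
    unfolding walk_Suc_shift by (simp add: walk_def)
  finally have "Max ((\<lambda>k. walk X k \<omega>) ` {0..Suc n})
      = max 0 (Max ((\<lambda>k. X 1 \<omega> + walk (\<lambda>j. X (Suc j)) k \<omega>) ` {0..n}))"
    by (simp only:) (rule Max_insert; simp)
  also have "Max ((\<lambda>k. X 1 \<omega> + walk (\<lambda>j. X (Suc j)) k \<omega>) ` {0..n})
      = X 1 \<omega> + Max ((\<lambda>k. walk (\<lambda>j. X (Suc j)) k \<omega>) ` {0..n})"
    using Max_add_commute[of "{0..n}" "\<lambda>k. walk (\<lambda>j. X (Suc j)) k \<omega>" "X 1 \<omega>"]
    by (simp only: add.commute finite_atLeastAtMost) simp
  finally show ?thesis unfolding walk_max_def .
qed

lemma walk_max_measurable [measurable]: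
  assumes [measurable]: "\<And>j. j \<ge> 1 \<Longrightarrow> X j \<in> borel_measurable M"
  shows "walk_max X n \<in> borel_measurable M"
  unfolding walk_max_def walk_def
  by (intro borel_measurable_Max borel_measurable_sum assms) auto

lemma (in prob_space) symmetric_steps_prob:
  assumes "symmetric_steps M X" "j \<ge> 1"
  shows "X j \<in> borel_measurable M" "prob {\<omega> \<in> space M. X j \<omega> = 1} = 1/2"
    "prob {\<omega> \<in> space M. X j \<omega> = -1} = 1/2"
proof -
  have rv: "X i \<in> borel_measurable M" if "i \<ge> 1" for i
    using assms(1) that unfolding symmetric_steps_def indep_vars_def by blast
  have D: "distr M borel (X j) = distr M borel (X 1)"
    using assms unfolding symmetric_steps_def by blast
  have eq: "prob {\<omega> \<in> space M. X j \<omega> = a} = prob {\<omega> \<in> space M. X 1 \<omega> = a}" for a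
    using arg_cong[OF D, of "\<lambda>D. measure D {a}"] rv[of 1] rv[of j] assms(2)
    by (simp add: measure_distr vimage_def Int_def conj_commute)
  show "X j \<in> borel_measurable M" "prob {\<omega> \<in> space M. X j \<omega> = 1} = 1/2"
    "prob {\<omega> \<in> space M. X j \<omega> = -1} = 1/2"
    using rv[of j] assms unfolding eq symmetric_steps_def by blast+
qed

lemma (in prob_space) symmetric_steps_shift:
  assumes "symmetric_steps M X"
  shows "symmetric_steps M (\<lambda>j. X (Suc j))"
proof -
  have "indep_vars (\<lambda>_. borel) X {1..}"
    using assms unfolding symmetric_steps_def by blast
  then have "indep_vars (\<lambda>j. PiM {Suc j} (\<lambda>_. borel)) (\<lambda>j \<omega>. restrict (\<lambda>i. X i \<omega>) {Suc j}) {1..}"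
    by (rule indep_vars_restrict) (auto simp: disjoint_family_on_def)
  then have "indep_vars (\<lambda>_. borel) (\<lambda>j \<omega>. restrict (\<lambda>i. X i \<omega>) {Suc j} (Suc j)) {1..}"
    by (rule indep_vars_compose2[where Y = "\<lambda>j x. x (Suc j)"]) auto
  then have "indep_vars (\<lambda>_. borel) (\<lambda>j. X (Suc j)) {1..}"
    by simp
  moreover have "distr M borel (X j) = distr M borel (X 1)" if "j \<ge> 1" for j
    using assms that unfolding symmetric_steps_def by blast
  then have "distr M borel (X (Suc j)) = distr M borel (X (Suc 1))" for j
    by (metis One_nat_def le_numeral_extra(4) plus_1_eq_Suc le_add1)
  moreover have "prob {\<omega> \<in> space M. X (Suc 1) \<omega> = 1} = 1/2" "prob {\<omega> \<in> space M. X (Suc 1) \<omega> = - 1} = 1/2"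
    by (rule symmetric_steps_prob[OF assms]; simp)+
  ultimately show ?thesis
    unfolding symmetric_steps_def by blast
qed

lemma (in prob_space) indep_first_step_walk_max_shift:
  assumes "symmetric_steps M X"
  shows "indep_var borel (X 1) borel (walk_max (\<lambda>j. X (Suc j)) n)"
proof -
  have "indep_vars (\<lambda>_. borel) X {1..}"
    using assms unfolding symmetric_steps_def by blast
  then have "indep_var borel ((\<lambda>x. x 1) \<circ> (\<lambda>\<omega>. restrict (\<lambda>i. X i \<omega>) {1}))
     borel ((\<lambda>x. walk_max (\<lambda>j y. y (Suc j)) n x) \<circ> (\<lambda>\<omega>. restrict (\<lambda>i. X i \<omega>) {2..}))"
    by (intro indep_var_compose[OF indep_var_restrict] walk_max_measurable) auto
  also have "(\<lambda>x. walk_max (\<lambda>j y. y (Suc j)) n x) \<circ> (\<lambda>\<omega>. restrict (\<lambda>i. X i \<omega>) {2..})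
      = walk_max (\<lambda>j. X (Suc j)) n"
    by (auto simp: fun_eq_iff walk_max_def walk_def intro!: arg_cong[where f = Max] image_cong sum.cong)
  finally show ?thesis by (simp add: comp_def)
qed

text \<open>
  The reflection principle in the form \<open>M\<^sub>n = \<bar>S\<^sub>n + 1/2\<bar> - 1/2\<close> in law. Both sides evolve by
  \<open>r \<mapsto> max 0 (r \<plusminus> 1)\<close> with fair signs: the maximum by decomposition at the first step, which is
  independent of the maximum of the remaining walk, and the folded walk by the lemma on one folded step.
\<close>

lemma (in prob_space) expectation_walk_max:
  assumes "symmetric_steps M X" and [measurable]: "g \<in> borel_measurable borel"
  shows "integrable M (\<lambda>\<omega>. g (walk_max X n \<omega>)) \<and>
    expectation (\<lambda>\<omega>. g (walk_max X n \<omega>)) = srw_mean n (\<lambda>s. g (of_int (fold_mirror s)))"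
  using assms
proof (induction n arbitrary: X g)
  case 0
  then show ?case by (simp add: walk_max_def walk_def fold_mirror_def prob_space)
next
  case (Suc n)
  note [measurable] = Suc.prems(2) symmetric_steps_prob(1)[OF Suc.prems(1)]
  let ?Y = "walk_max (\<lambda>j. X (Suc j)) n"
  let ?up = "\<lambda>y. g (max 0 (1 + y))" and ?down = "\<lambda>y. g (max 0 (- 1 + y))"
  let ?I = "\<lambda>a. indicator {a} :: real \<Rightarrow> real"
  have IH: "integrable M (\<lambda>\<omega>. f (?Y \<omega>)) \<and>
      expectation (\<lambda>\<omega>. f (?Y \<omega>)) = srw_mean n (\<lambda>s. f (of_int (fold_mirror s)))"
    if "f \<in> borel_measurable borel" for f
    using Suc.IH[OF symmetric_steps_shift[OF Suc.prems(1)] that] .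
  have prob: "expectation (\<lambda>\<omega>. ?I a (X 1 \<omega>)) = 1/2" if "a = 1 \<or> a = -1" for a
  proof -
    have "expectation (\<lambda>\<omega>. ?I a (X 1 \<omega>)) = expectation (indicator {\<omega> \<in> space M. X 1 \<omega> = a})"
      by (intro Bochner_Integration.integral_cong) (auto simp: indicator_def)
    also have "\<dots> = prob {\<omega> \<in> space M. X 1 \<omega> = a}" by simp
    finally show ?thesis using that symmetric_steps_prob[OF Suc.prems(1), of 1] by auto
  qed
  have prod: "integrable M (\<lambda>\<omega>. ?I a (X 1 \<omega>) * f (?Y \<omega>)) \<and>
      expectation (\<lambda>\<omega>. ?I a (X 1 \<omega>) * f (?Y \<omega>)) = srw_mean n (\<lambda>s. f (of_int (fold_mirror s))) / 2"
    if a: "a = 1 \<or> a = -1" and f [measurable]: "f \<in> borel_measurable borel" for a f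
  proof -
    have "indep_var borel (?I a \<circ> X 1) borel (f \<circ> ?Y)"
      by (rule indep_var_compose[OF indep_first_step_walk_max_shift[OF Suc.prems(1)]]) auto
    moreover have "integrable M (\<lambda>\<omega>. ?I a (X 1 \<omega>))"
      by (rule integrable_const_bound[where B = 1]) (auto simp: indicator_def)
    ultimately show ?thesis
      using indep_var_integrable[of "?I a \<circ> X 1" "f \<circ> ?Y"] 
        indep_var_lebesgue_integral[of "?I a \<circ> X 1" "f \<circ> ?Y"] IH[OF f] prob[OF a]
      by (simp add: comp_def)
  qed
  have "AE \<omega> in M. X 1 \<omega> = 1 \<or> X 1 \<omega> = -1"
  proof -
    have "{\<omega> \<in> space M. X 1 \<omega> = 1 \<or> X 1 \<omega> = -1} = {\<omega> \<in> space M. X 1 \<omega> = 1} \<union> {\<omega> \<in> space M. X 1 \<omega> = -1}"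
      by auto
    then have "prob {\<omega> \<in> space M. X 1 \<omega> = 1 \<or> X 1 \<omega> = -1} = 1"
      using symmetric_steps_prob[OF Suc.prems(1), of 1]
      by (simp add: finite_measure_Union disjoint_iff)
    then show ?thesis
      by (subst (asm) prob_Collect_eq_1) auto
  qed
  then have ae: "AE \<omega> in M. g (walk_max X (Suc n) \<omega>)
      = ?I 1 (X 1 \<omega>) * ?up (?Y \<omega>) + ?I (-1) (X 1 \<omega>) * ?down (?Y \<omega>)"
    by eventually_elim (auto simp: walk_max_Suc_shift)
  have up: "?up \<in> borel_measurable borel" and down: "?down \<in> borel_measurable borel"
    by measurable
  have meas: "(\<lambda>\<omega>. g (walk_max X (Suc n) \<omega>)) \<in> borel_measurable M" 
    by measurable
  have "expectation (\<lambda>\<omega>. g (walk_max X (Suc n) \<omega>))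
      = expectation (\<lambda>\<omega>. ?I 1 (X 1 \<omega>) * ?up (?Y \<omega>) + ?I (-1) (X 1 \<omega>) * ?down (?Y \<omega>))"
    using prod[OF _ up, of 1] prod[OF _ down, of "-1"]
    by (intro integral_cong_AE meas ae) (auto intro: borel_measurable_integrable)
  also have "\<dots> = (srw_mean n (\<lambda>s. ?up (of_int (fold_mirror s))) + srw_mean n (\<lambda>s. ?down (of_int (fold_mirror s)))) / 2"
    using prod[OF _ up, of 1] prod[OF _ down, of "-1"] by simp
  also have "\<dots> = srw_mean (Suc n) (\<lambda>s. g (of_int (fold_mirror s)))"
    by (simp only: srw_mean.simps srw_mean_add[symmetric] fold_mirror_step)
  finally have "expectation (\<lambda>\<omega>. g (walk_max X (Suc n) \<omega>)) = srw_mean (Suc n) (\<lambda>s. g (of_int (fold_mirror s)))" .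
  moreover have "integrable M (\<lambda>\<omega>. g (walk_max X (Suc n) \<omega>))"
    using prod[OF _ up, of 1] prod[OF _ down, of "-1"]
    by (subst integrable_cong_AE[OF meas _ ae]) auto
  ultimately show ?case by simp
qed

section \<open>Tails of the normal density\<close>

abbreviation \<phi> :: "real \<Rightarrow> real" where
  "\<phi> \<equiv> std_normal_density"

definition gauss_mean :: "(real \<Rightarrow> real) \<Rightarrow> real" where
  "gauss_mean h = (\<integral>t. \<phi> t * h t \<partial>lborel)"

definition gauss_tail :: "real \<Rightarrow> real" where
  "gauss_tail x = (LINT t:{x..}|lborel. \<phi> t)"

lemma gauss_pos: "\<phi> x > 0"
  by (simp add: normal_density_pos)

lemma gauss_minus: "\<phi> (- x) = \<phi> x"
  by (simp add: std_normal_density_def)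

lemma gauss_le: "\<phi> x \<le> sqrt (2 / pi) / 2"
proof -
  have "\<phi> x \<le> 1 / sqrt (2 * pi)"
    by (auto simp: std_normal_density_def mult_le_cancel_left1 divide_le_cancel)
  also have "\<dots> = sqrt (2 / pi) / 2"
  proof -
    have "sqrt (2 * pi) * sqrt (2 / pi) = 2" by (simp flip: real_sqrt_mult)
    then show ?thesis by (simp add: field_simps)
  qed
  finally show ?thesis .
qed

lemma gauss_deriv: "(\<phi> has_real_derivative - (x * \<phi> x)) (at x)"
proof -
  have "((\<lambda>x. k * exp (- x\<^sup>2 / 2)) has_real_derivative - (x * (k * exp (- x\<^sup>2 / 2)))) (at x)" for k
    by (auto intro!: derivative_eq_intros)
  from this[of "1 / sqrt (2 * pi)"] show ?thesis by (simp add: std_normal_density_def[abs_def])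
qed

lemma gauss_continuous: "isCont \<phi> x"
  using DERIV_isCont[OF gauss_deriv] .

lemma gauss_moments_integrable:
  "integrable lborel \<phi>" "integrable lborel (\<lambda>t. t * \<phi> t)" "integrable lborel (\<lambda>t. \<bar>t\<bar> * \<phi> t)"
  "integrable lborel (\<lambda>t. t\<^sup>2 * \<phi> t)"
  using integrable_std_normal_moment[of 0] integrable_std_normal_moment[of 1]
    integrable_std_normal_moment_abs[of 1] integrable_std_normal_moment[of 2]
  by (simp_all add: mult.commute)

lemma set_integrableI_integrable: "integrable lborel f \<Longrightarrow> A \<in> sets borel \<Longrightarrow> set_integrable lborel A f"
  for f :: "real \<Rightarrow> real"
  unfolding set_integrable_def by (rule integrable_mult_indicator) auto

lemma set_integral_atLeast_FTC:
  fixes f F :: "real \<Rightarrow> real"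
  assumes F: "\<And>t. (F has_real_derivative f t) (at t)" and f: "\<And>t. isCont f t"
    and int: "integrable lborel f" and lim: "(F \<longlongrightarrow> 0) at_top"
  shows "(LINT t:{x..}|lborel. f t) = - F x"
proof (rule tendsto_unique[OF trivial_limit_at_top_linorder])
  show "((\<lambda>b. LINT t:{x..b}|lborel. f t) \<longlongrightarrow> (LINT t:{x..}|lborel. f t)) at_top"
    using int by (intro tendsto_set_lebesgue_integral_at_top set_integrableI_integrable) auto
  have "((\<lambda>b. F b - F x) \<longlongrightarrow> 0 - F x) at_top"
    by (intro tendsto_intros lim)
  moreover have "\<forall>\<^sub>F b in at_top. F b - F x = (LINT t:{x..b}|lborel. f t)"
    using eventually_ge_at_top[of x]
    by eventually_elim
      (simp add: set_lebesgue_integral_def integral_FTC_Icc_real[OF _ F f] mult.commute)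
  ultimately show "((\<lambda>b. LINT t:{x..b}|lborel. f t) \<longlongrightarrow> - F x) at_top"
    by (auto intro: Lim_transform_eventually)
qed

lemma set_integral_greaterThan:
  fixes f :: "real \<Rightarrow> real"
  assumes "integrable lborel f"
  shows "(LINT t:{x<..}|lborel. f t) = (LINT t:{x..}|lborel. f t)"
  unfolding set_lebesgue_integral_def
  using AE_lborel_singleton[of x] borel_measurable_integrable[OF assms]
  by (intro integral_cong_AE) (auto elim!: eventually_mono simp: indicator_def)

lemma set_integral_atMost_eq:
  fixes f :: "real \<Rightarrow> real"
  assumes "integrable lborel f"
  shows "(LINT t:{..x}|lborel. f t) = (\<integral>t. f t \<partial>lborel) - (LINT t:{x..}|lborel. f t)"
proof -
  have "(LINT t:{..x} \<union> {x<..}|lborel. f t) = (LINT t:{..x}|lborel. f t) + (LINT t:{x<..}|lborel. f t)"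
    by (intro set_integral_Un set_integrableI_integrable assms) auto
  moreover have "{..x} \<union> {x<..} = UNIV" by auto
  ultimately show ?thesis
    using set_integral_greaterThan[OF assms, of x] by (simp add: set_lebesgue_integral_def)
qed

lemma integral_lborel_reflect: "(\<integral>t. f (- t) \<partial>lborel) = (\<integral>t. f t \<partial>lborel)" for f :: "real \<Rightarrow> real"
  using lborel_integral_real_affine[of "-1" f 0] by simp

lemma integrable_lborel_reflect: "integrable lborel f \<Longrightarrow> integrable lborel (\<lambda>t. f (- t))" for f :: "real \<Rightarrow> real"
  using lborel_integrable_real_affine[of f "-1" 0] by simp

lemma set_integral_reflect_atLeast:
  fixes f :: "real \<Rightarrow> real"
  shows "(LINT t:{x..}|lborel. f (- t)) = (LINT t:{..- x}|lborel. f t)"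
proof -
  have "(LINT t:{x..}|lborel. f (- t)) = (\<integral>t. (\<lambda>s. indicator {..- x} s *\<^sub>R f s) (- t) \<partial>lborel)"
    unfolding set_lebesgue_integral_def
    by (intro Bochner_Integration.integral_cong) (auto simp: indicator_def)
  also have "\<dots> = (\<integral>t. indicator {..- x} t *\<^sub>R f t \<partial>lborel)"
    by (rule integral_lborel_reflect)
  finally show ?thesis
    unfolding set_lebesgue_integral_def .
qed

lemma gauss_integral: "(\<integral>t. \<phi> t \<partial>lborel) = 1"
  using integral_std_normal_moment_even[of 0] by simp

lemma gauss_tail_0: "gauss_tail 0 = 1 / 2"
  using set_integral_reflect_atLeast[of 0 \<phi>] set_integral_atMost_eq[OF gauss_moments_integrable(1), of 0]
  by (simp add: gauss_tail_def gauss_minus gauss_integral)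

lemma gauss_tail_first_moment: "(LINT t:{x..}|lborel. t * \<phi> t) = \<phi> x"
proof -
  have "((\<lambda>t. - \<phi> t) \<longlongrightarrow> 0) at_top"
    unfolding std_normal_density_def by real_asymp
  then have "(LINT t:{x..}|lborel. t * \<phi> t) = - (- \<phi> x)"
    by (intro set_integral_atLeast_FTC gauss_moments_integrable)
      (auto intro!: continuous_intros gauss_continuous derivative_eq_intros gauss_deriv)
  then show ?thesis by simp
qed

lemma gauss_tail_second_moment: "(LINT t:{x..}|lborel. t\<^sup>2 * \<phi> t) = x * \<phi> x + gauss_tail x"
proof -
  have "((\<lambda>t. - (t * \<phi> t)) \<longlongrightarrow> 0) at_top"
    unfolding std_normal_density_def by real_asymp
  moreover have "integrable lborel (\<lambda>t. t\<^sup>2 * \<phi> t - \<phi> t)"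
    by (intro Bochner_Integration.integrable_diff gauss_moments_integrable)
  ultimately have "(LINT t:{x..}|lborel. t\<^sup>2 * \<phi> t - \<phi> t) = - (- (x * \<phi> x))"
    by (intro set_integral_atLeast_FTC)
      (auto intro!: continuous_intros gauss_continuous derivative_eq_intros gauss_deriv simp: power2_eq_square)
  then show ?thesis
    by (simp add: set_integral_diff set_integrableI_integrable gauss_moments_integrable gauss_tail_def)
qed

text \<open>
  The integral of \<open>(t - x) \<phi>(t)\<close> over \<open>t \<ge> x\<close> is nonnegative.
\<close>

lemma gauss_tail_le_div: "x * gauss_tail x \<le> \<phi> x"
proof -
  have "0 \<le> (LINT t:{x..}|lborel. t * \<phi> t - x * \<phi> t)"
    unfolding set_lebesgue_integral_def
    by (intro Bochner_Integration.integral_nonneg) (auto simp: indicator_def mult_right_mono)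
  also have "\<dots> = (LINT t:{x..}|lborel. t * \<phi> t) - (LINT t:{x..}|lborel. x * \<phi> t)"
    by (intro set_integral_diff set_integrableI_integrable integrable_mult_right gauss_moments_integrable) auto
  finally show ?thesis by (simp add: gauss_tail_first_moment gauss_tail_def)
qed

text \<open>
  The lower Mills bound: the integral of \<open>(t - x)\<^sup>2 \<phi>(t)\<close> over \<open>t \<ge> x\<close> is nonnegative, and the first
  three tail moments are explicit.
\<close>

lemma gauss_tail_ge: "x * \<phi> x \<le> (1 + x\<^sup>2) * gauss_tail x"
proof -
  have "0 \<le> (LINT t:{x..}|lborel. (t\<^sup>2 * \<phi> t - 2 * x * (t * \<phi> t)) + x\<^sup>2 * \<phi> t)"
    unfolding set_lebesgue_integral_def
  proof (intro Bochner_Integration.integral_nonneg)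
    fix t :: real
    have "(t\<^sup>2 * \<phi> t - 2 * x * (t * \<phi> t)) + x\<^sup>2 * \<phi> t = (t - x)\<^sup>2 * \<phi> t"
      by (simp add: power2_eq_square algebra_simps)
    then show "0 \<le> indicator {x..} t *\<^sub>R ((t\<^sup>2 * \<phi> t - 2 * x * (t * \<phi> t)) + x\<^sup>2 * \<phi> t)"
      by simp
  qed
  also have "\<dots> = (LINT t:{x..}|lborel. t\<^sup>2 * \<phi> t) - 2 * x * (LINT t:{x..}|lborel. t * \<phi> t) + x\<^sup>2 * gauss_tail x"
    by (simp add: set_integral_diff set_integral_add set_integrableI_integrable
      gauss_moments_integrable gauss_tail_def set_integral_mult_right)
  finally show ?thesis
    unfolding gauss_tail_first_moment gauss_tail_second_moment
    by (simp add: power2_eq_square algebra_simps)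
qed

text \<open>
  For \<open>t \<ge> x \<ge> 0\<close> one has \<open>t\<^sup>2 \<ge> x\<^sup>2 + (t - x)\<^sup>2\<close>, so \<open>\<phi>(t)/\<phi>(x) \<le> \<phi>(t - x)/\<phi>(0)\<close>, and the half
  mass \<open>1/2\<close> of \<open>\<phi>\<close> gives the constant \<open>1/(2 \<phi>(0)) = \<surd>(\<pi>/2)\<close>, attained at \<open>x = 0\<close>.
\<close>

lemma gauss_tail_le:
  assumes "x \<ge> 0"
  shows "gauss_tail x \<le> sqrt (pi / 2) * \<phi> x"
proof -
  have sq: "sqrt (2 * pi) = 2 * sqrt (pi / 2)"
  proof -
    have "2 * pi = 2\<^sup>2 * (pi / 2)" by simp
    then show ?thesis by (metis real_sqrt_mult real_sqrt_abs abs_numeral)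
  qed
  have "\<phi> t \<le> sqrt (2 * pi) * \<phi> x * \<phi> (t - x)" if "t \<ge> x" for t
  proof -
    have "x\<^sup>2 + (t - x)\<^sup>2 \<le> t\<^sup>2"
      using that assms mult_left_mono[of x t x] by (simp add: power2_eq_square algebra_simps)
    then have "exp (- t\<^sup>2 / 2) \<le> exp (- x\<^sup>2 / 2) * exp (- (t - x)\<^sup>2 / 2)"
      unfolding exp_add[symmetric] by (simp add: field_simps)
    then show ?thesis
      by (simp add: std_normal_density_def divide_right_mono)
  qed
  moreover have "integrable lborel (\<lambda>t. \<phi> (t - x))"
    using lborel_integrable_real_affine[OF gauss_moments_integrable(1), of 1 "- x"] by simp
  ultimately have "gauss_tail x \<le> (LINT t:{x..}|lborel. sqrt (2 * pi) * \<phi> x * \<phi> (t - x))"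
    unfolding gauss_tail_def
    by (intro set_integral_mono set_integrableI_integrable gauss_moments_integrable integrable_mult_right) auto
  also have "\<dots> = sqrt (2 * pi) * \<phi> x * (LINT t:{x..}|lborel. \<phi> (t - x))"
    by simp
  also have "(LINT t:{x..}|lborel. \<phi> (t - x)) = (\<integral>t. (\<lambda>s. indicator {0..} s *\<^sub>R \<phi> s) (- x + 1 * t) \<partial>lborel)"
    unfolding set_lebesgue_integral_def
    by (intro Bochner_Integration.integral_cong) (auto simp: indicator_def)
  also have "\<dots> = gauss_tail 0"
    using lborel_integral_real_affine[of 1 "\<lambda>s. indicator {0..} s *\<^sub>R \<phi> s" "- x"]
    by (simp add: gauss_tail_def set_lebesgue_integral_def)
  finally show ?thesis by (simp add: gauss_tail_0 sq)
qed

section \<open>Solutions of the Stein equation\<close>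

text \<open>
  A solution of the Stein equation \<open>f'(x) - x f(x) = h(x) - E[h(Z)]\<close>, obtained from the integrating
  factor \<open>\<phi>\<close>. All other solutions add a multiple of \<open>1/\<phi>\<close>, which is unbounded.
\<close>

definition stein_sol :: "(real \<Rightarrow> real) \<Rightarrow> real \<Rightarrow> real" where
  "stein_sol h x = (LINT t:{..x}|lborel. \<phi> t * (h t - gauss_mean h)) / \<phi> x"

lemma centred_integrable:
  assumes "integrable lborel (\<lambda>t. \<phi> t * h t)"
  shows "integrable lborel (\<lambda>t. \<phi> t * (h t - c))"
  using assms gauss_moments_integrable(1) by (simp add: right_diff_distrib)

lemma centred_integral:
  assumes "integrable lborel (\<lambda>t. \<phi> t * h t)"
  shows "(\<integral>t. \<phi> t * (h t - gauss_mean h) \<partial>lborel) = 0"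
  using assms gauss_moments_integrable(1)
  by (simp add: right_diff_distrib gauss_mean_def gauss_integral)

text \<open>
  As \<open>\<phi> (h - E[h(Z)])\<close> has total integral \<open>0\<close>, the solution is also given by the right tail; for
  \<open>x \<ge> 0\<close> this is the form that can be estimated, since the Gaussian tail is small there.
\<close>

lemma stein_sol_atLeast:
  assumes "integrable lborel (\<lambda>t. \<phi> t * h t)"
  shows "stein_sol h x = - (LINT t:{x..}|lborel. \<phi> t * (h t - gauss_mean h)) / \<phi> x"
  unfolding stein_sol_def set_integral_atMost_eq[OF centred_integrable[OF assms]]
    centred_integral[OF assms] by simp

lemma gauss_mean_reflect: "gauss_mean (\<lambda>t. h (- t)) = gauss_mean h"
  using integral_lborel_reflect[of "\<lambda>t. \<phi> t * h t"] by (simp add: gauss_mean_def gauss_minus)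

lemma stein_sol_reflect:
  assumes "integrable lborel (\<lambda>t. \<phi> t * h t)"
  shows "stein_sol (\<lambda>t. h (- t)) (- x) = - stein_sol h x"
  unfolding stein_sol_atLeast[OF assms] unfolding stein_sol_def gauss_mean_reflect gauss_minus
  using set_integral_reflect_atLeast[of x "\<lambda>t. \<phi> t * (h (- t) - gauss_mean h)"]
  by (simp add: gauss_minus)

text \<open>
  The equation in integrated form. At a jump of \<open>h\<close> the solution is continuous but not
  differentiable, and the fundamental theorem of calculus tolerates finitely many such points.
\<close>

lemma stein_sol_equation:
  assumes int: "integrable lborel (\<lambda>t. \<phi> t * h t)"
    and S: "finite S" "\<And>t. t \<notin> S \<Longrightarrow> isCont h t" and "a \<le> b"
  shows "((\<lambda>t. t * stein_sol h t + h t - gauss_mean h) has_integral (stein_sol h b - stein_sol h a)) {a..b}"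
proof -
  let ?c = "gauss_mean h"
  define G where "G = (\<lambda>t. \<phi> t * (h t - ?c))"
  define I where "I = (\<lambda>x. LINT t:{..x}|lborel. G t)"
  have G: "set_integrable lborel A G" if "A \<in> sets borel" for A
    unfolding G_def by (intro set_integrableI_integrable centred_integrable int that)
  have Gint: "G integrable_on {a..b}"
    using set_borel_integral_eq_integral(1)[OF G] by simp
  have I_eq: "I x = I a + integral {a..x} G" if "a \<le> x" for x
  proof -
    have "(LINT t:{..a} \<union> {a<..x}|lborel. G t) = I a + (LINT t:{a<..x}|lborel. G t)"
      unfolding I_def by (intro set_integral_Un G) auto
    moreover have "{..a} \<union> {a<..x} = {..x}" using that by auto
    moreover have "(LINT t:{a<..x}|lborel. G t) = (LINT t:{a..x}|lborel. G t)"
      unfolding set_lebesgue_integral_def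
      using AE_lborel_singleton[of a] G[of "{a<..x}"] G[of "{a..x}"]
      by (intro integral_cong_AE)
        (auto elim!: eventually_mono simp: indicator_def set_integrable_def dest!: borel_measurable_integrable)
    ultimately show ?thesis
      using set_borel_integral_eq_integral(2)[OF G[of "{a..x}"]] by (simp add: I_def)
  qed
  \<comment> \<open>On \<open>{a..b}\<close> the solution has a form to which the calculus of indefinite integrals applies.\<close>
  define f where "f = (\<lambda>x. (I a + integral {a..x} G) / \<phi> x)"
  have f: "stein_sol h x = f x" if "a \<le> x" for x
    using I_eq[OF that] by (simp add: f_def stein_sol_def I_def G_def)
  have "((\<lambda>t. t * f t + h t - ?c) has_integral (f b - f a)) {a..b}"
  proof (rule fundamental_theorem_of_calculus_interior_strong[OF S(1) \<open>a \<le> b\<close>])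
    fix x assume x: "x \<in> {a<..<b} - S"
    have "isCont G x"
      unfolding G_def by (intro continuous_intros gauss_continuous S(2)) (use x in auto)
    then have "continuous (at x within ({a..b} - {})) G"
      by (simp add: continuous_at_imp_continuous_at_within)
    then have "((\<lambda>u. integral {a..u} G) has_vector_derivative G x) (at x within ({a..b} - {}))"
      using x by (intro integral_has_vector_derivative_continuous_at Gint) auto
    then have "((\<lambda>u. integral {a..u} G) has_real_derivative G x) (at x)"
      using x by (simp add: has_real_derivative_iff_has_vector_derivative at_within_Icc_at)
    then have "(f has_real_derivative x * f x + h x - ?c) (at x)"
      unfolding f_def using gauss_pos[of x]
      by (auto intro!: derivative_eq_intros gauss_deriv simp: G_def field_simps power2_eq_square)
    then show "(f has_vector_derivative x * f x + h x - ?c) (at x)"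
      by (simp add: has_real_derivative_iff_has_vector_derivative)
  next
    show "continuous_on {a..b} f"
      unfolding f_def using gauss_pos
      by (intro continuous_intros indefinite_integral_continuous_1 Gint continuous_at_imp_continuous_on ballI gauss_continuous)
        (auto simp: less_imp_neq[symmetric])
  qed
  then have "((\<lambda>t. t * stein_sol h t + h t - ?c) has_integral (f b - f a)) {a..b}"
    by (rule has_integral_eq[rotated]) (simp add: f)
  then show ?thesis using \<open>a \<le> b\<close> by (simp add: f)
qed

lemma set_integral_abs_le:
  fixes f g :: "real \<Rightarrow> real"
  assumes "integrable lborel f" "integrable lborel g" "A \<in> sets borel" "\<And>t. t \<in> A \<Longrightarrow> \<bar>f t\<bar> \<le> g t"
  shows "\<bar>LINT t:A|lborel. f t\<bar> \<le> (LINT t:A|lborel. g t)"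
proof -
  have "\<bar>LINT t:A|lborel. f t\<bar> \<le> (LINT t:A|lborel. \<bar>f t\<bar>)"
    using set_integral_norm_bound[OF set_integrableI_integrable[OF assms(1,3)]] by simp
  also have "\<dots> \<le> (LINT t:A|lborel. g t)"
    using assms by (intro set_integral_mono set_integrableI_integrable) auto
  finally show ?thesis .
qed

text \<open>
  Reflecting \<open>h\<close> reflects and negates the solution, so for a class of test functions closed under
  reflection it suffices to bound solutions on the right half-line.
\<close>

lemma stein_sol_bound_reflect:
  assumes "\<And>h x. P h \<Longrightarrow> x \<ge> 0 \<Longrightarrow> \<bar>stein_sol h x\<bar> \<le> B \<and> \<bar>x * stein_sol h x + h x - gauss_mean h\<bar> \<le> A"
    and "P h" "P (\<lambda>t. h (- t))" and int: "integrable lborel (\<lambda>t. \<phi> t * h t)"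
  shows "\<bar>stein_sol h x\<bar> \<le> B" "\<bar>x * stein_sol h x + h x - gauss_mean h\<bar> \<le> A"
  using assms(1)[of h x, OF assms(2)] assms(1)[of "\<lambda>t. h (- t)" "- x", OF assms(3)]
  by (cases "x \<ge> 0"; simp add: stein_sol_reflect[OF int] gauss_mean_reflect)+

text \<open>
  Here \<open>\<bar>h - E[h(Z)]\<bar> \<le> 1\<close>, so \<open>\<bar>f\<bar>\<close> is at most the Mills ratio \<open>r\<close> at \<open>x \<ge> 0\<close>. Both \<open>r \<le> \<surd>(\<pi>/2)\<close> and
  \<open>x r \<le> 1\<close> hold; the latter bounds \<open>x f(x)\<close>, and hence \<open>f'\<close> by \<open>1 + 1\<close>.
\<close>

lemma stein_sol_bounds_unit_range:
  assumes [measurable]: "h \<in> borel_measurable borel" and h: "\<And>t. h t \<in> {0..1}"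
  shows "integrable lborel (\<lambda>t. \<phi> t * h t)"
    and "\<bar>stein_sol h x\<bar> \<le> sqrt (pi / 2)"
    and "\<bar>x * stein_sol h x + h x - gauss_mean h\<bar> \<le> 2"
proof -
  let ?P = "\<lambda>h::real\<Rightarrow>real. h \<in> borel_measurable borel \<and> (\<forall>t. h t \<in> {0..1})"
  have int: "integrable lborel (\<lambda>t. \<phi> t * h t)" if "?P h" for h
    by (rule Bochner_Integration.integrable_bound[OF gauss_moments_integrable(1)])
      (use that in \<open>auto simp: abs_mult mult_left_le\<close>)
  have *: "\<bar>stein_sol h x\<bar> \<le> sqrt (pi / 2) \<and> \<bar>x * stein_sol h x + h x - gauss_mean h\<bar> \<le> 2"
    if P: "?P h" and x: "x \<ge> 0" for h x
  proof -
    have "0 \<le> gauss_mean h"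
      unfolding gauss_mean_def using P by (intro Bochner_Integration.integral_nonneg) auto
    moreover have "gauss_mean h \<le> (\<integral>t. \<phi> t \<partial>lborel)"
      unfolding gauss_mean_def using P
      by (intro integral_mono int gauss_moments_integrable) (auto simp: mult_left_le)
    ultimately have c: "\<bar>h t - gauss_mean h\<bar> \<le> 1" for t
      using P[THEN conjunct2, rule_format, of t] by (auto simp: gauss_integral abs_le_iff)
    have "\<bar>LINT t:{x..}|lborel. \<phi> t * (h t - gauss_mean h)\<bar> \<le> (LINT t:{x..}|lborel. \<phi> t)"
      using c by (intro set_integral_abs_le centred_integrable int P gauss_moments_integrable)
        (auto simp: abs_mult mult_left_le)
    then have f: "\<bar>stein_sol h x\<bar> \<le> gauss_tail x / \<phi> x"
      unfolding stein_sol_atLeast[OF int[OF P]] gauss_tail_def using gauss_pos[of x]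
      by (simp add: divide_right_mono)
    also have "\<dots> \<le> sqrt (pi / 2)"
      using gauss_tail_le[OF x] gauss_pos[of x] by (simp add: field_simps)
    finally have "\<bar>stein_sol h x\<bar> \<le> sqrt (pi / 2)" .
    moreover have "\<bar>x * stein_sol h x\<bar> \<le> 1"
    proof -
      have "\<bar>x * stein_sol h x\<bar> \<le> x * (gauss_tail x / \<phi> x)"
        unfolding abs_mult using mult_left_mono[OF f x] x by simp
      also have "\<dots> \<le> 1" using gauss_tail_le_div[of x] gauss_pos[of x] by simp
      finally show ?thesis .
    qed
    ultimately show ?thesis using c[of x] by (simp add: abs_le_iff)
  qed
  have P: "?P h" "?P (\<lambda>t. h (- t))" using assms by auto
  show "integrable lborel (\<lambda>t. \<phi> t * h t)" by (rule int[OF P(1)])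
  show "\<bar>stein_sol h x\<bar> \<le> sqrt (pi / 2)" "\<bar>x * stein_sol h x + h x - gauss_mean h\<bar> \<le> 2"
    by (rule stein_sol_bound_reflect[OF * P int[OF P(1)]]; assumption)+
qed

lemma gauss_abs_mean: "(\<integral>t. \<bar>t\<bar> * \<phi> t \<partial>lborel) = sqrt (2 / pi)"
  using integral_std_normal_moment_abs_odd[of 0] by (simp add: mult.commute)

text \<open>
  Averaging \<open>\<bar>h(t) - h(Z)\<bar> \<le> \<bar>t\<bar> + \<bar>Z\<bar>\<close> shows \<open>\<bar>h(t) - E[h(Z)]\<bar> \<le> \<bar>t\<bar> + a\<close> with
  \<open>a = E\<bar>Z\<bar> = \<surd>(2/\<pi>)\<close>; integrating this over the tail bounds \<open>f\<close>. For \<open>f'\<close> that estimate would grow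
  linearly in \<open>x\<close>. Splitting \<open>h(t) - E[h(Z)]\<close> at \<open>h(x)\<close> produces in both parts the factor
  \<open>1 - x r\<close>, with \<open>r\<close> the Mills ratio, and the lower Mills bound \<open>1 - x r \<le> 1/(1 + x\<^sup>2)\<close> compensates
  the linear growth.
\<close>

lemma stein_sol_bounds_lipschitz:
  assumes "1-lipschitz_on UNIV h"
  shows "integrable lborel (\<lambda>t. \<phi> t * h t)"
    and "\<bar>stein_sol h x\<bar> \<le> 2"
    and "\<bar>x * stein_sol h x + h x - gauss_mean h\<bar> \<le> 1 + sqrt (2 / pi)"
proof -
  let ?P = "\<lambda>h::real\<Rightarrow>real. 1-lipschitz_on UNIV h"
  let ?a = "sqrt (2 / pi)"
  have lip: "\<bar>h s - h t\<bar> \<le> \<bar>s - t\<bar>" if "?P h" for h s t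
    using lipschitz_onD[OF that, of s t] by (simp add: dist_real_def)
  have int: "integrable lborel (\<lambda>t. \<phi> t * h t)" if P: "?P h" for h
  proof (rule Bochner_Integration.integrable_bound)
    show "integrable lborel (\<lambda>t. \<bar>t\<bar> * \<phi> t + \<bar>h 0\<bar> * \<phi> t)"
      by (intro Bochner_Integration.integrable_add integrable_mult_right gauss_moments_integrable)
    have "h \<in> borel_measurable borel"
      by (intro borel_measurable_continuous_onI lipschitz_on_continuous_on[OF P])
    then show "(\<lambda>t. \<phi> t * h t) \<in> borel_measurable lborel" by simp
    have "\<bar>h t\<bar> \<le> \<bar>t\<bar> + \<bar>h 0\<bar>" for t using lip[OF P, of t 0] by linarith
    then have "\<phi> t * \<bar>h t\<bar> \<le> \<phi> t * (\<bar>t\<bar> + \<bar>h 0\<bar>)" for t by (intro mult_left_mono) auto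
    then show "AE t in lborel. norm (\<phi> t * h t) \<le> norm (\<bar>t\<bar> * \<phi> t + \<bar>h 0\<bar> * \<phi> t)"
      by (auto simp: abs_mult algebra_simps)
  qed
  have c: "\<bar>h t - gauss_mean h\<bar> \<le> \<bar>t\<bar> + ?a" if P: "?P h" for h t
  proof -
    have "\<phi> s * (h s - h t) \<le> \<bar>s\<bar> * \<phi> s + \<bar>t\<bar> * \<phi> s" "- (\<phi> s * (h s - h t)) \<le> \<bar>s\<bar> * \<phi> s + \<bar>t\<bar> * \<phi> s" for s
      using lip[OF P, of s t] mult_left_mono[of "h s - h t" "\<bar>s\<bar> + \<bar>t\<bar>" "\<phi> s"]
        mult_left_mono[of "h t - h s" "\<bar>s\<bar> + \<bar>t\<bar>" "\<phi> s"]
      by (auto simp: algebra_simps)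
    moreover have "integrable lborel (\<lambda>s. \<phi> s * (h s - h t))" "integrable lborel (\<lambda>s. \<bar>s\<bar> * \<phi> s + \<bar>t\<bar> * \<phi> s)"
      using centred_integrable[OF int[OF P]] gauss_moments_integrable by auto
    ultimately have "\<bar>\<integral>s. \<phi> s * (h s - h t) \<partial>lborel\<bar> \<le> (\<integral>s. \<bar>s\<bar> * \<phi> s + \<bar>t\<bar> * \<phi> s \<partial>lborel)"
      using set_integral_abs_le[of "\<lambda>s. \<phi> s * (h s - h t)" "\<lambda>s. \<bar>s\<bar> * \<phi> s + \<bar>t\<bar> * \<phi> s" UNIV]
      by (simp add: set_lebesgue_integral_def abs_le_iff)
    moreover have "(\<integral>s. \<phi> s * (h s - h t) \<partial>lborel) = gauss_mean h - h t"
      using int[OF P] gauss_moments_integrable(1)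
      by (simp add: right_diff_distrib gauss_mean_def gauss_integral)
    moreover have "(\<integral>s. \<bar>s\<bar> * \<phi> s + \<bar>t\<bar> * \<phi> s \<partial>lborel) = ?a + \<bar>t\<bar>"
      by (simp add: gauss_moments_integrable gauss_abs_mean gauss_integral)
    ultimately show ?thesis by (simp add: abs_minus_commute)
  qed
  have *: "\<bar>stein_sol h x\<bar> \<le> 2 \<and> \<bar>x * stein_sol h x + h x - gauss_mean h\<bar> \<le> 1 + ?a"
    if P: "?P h" and x: "x \<ge> 0" for h x
  proof -
    let ?c = "gauss_mean h"
    note [simp] = gauss_pos[of x]
    have a: "?a \<ge> 0" "?a * sqrt (pi / 2) = 1"
      by (simp_all flip: real_sqrt_mult)
    have "\<bar>LINT t:{x..}|lborel. \<phi> t * (h t - ?c)\<bar> \<le> (LINT t:{x..}|lborel. t * \<phi> t + ?a * \<phi> t)"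
    proof (intro set_integral_abs_le centred_integrable int P Bochner_Integration.integrable_add
        integrable_mult_right gauss_moments_integrable)
      fix t assume "t \<in> {x..}"
      then have "\<phi> t * \<bar>h t - ?c\<bar> \<le> \<phi> t * (t + ?a)"
        using c[OF P, of t] x by (intro mult_left_mono) auto
      then show "\<bar>\<phi> t * (h t - ?c)\<bar> \<le> t * \<phi> t + ?a * \<phi> t"
        unfolding abs_mult by (simp add: distrib_left mult.commute)
    qed simp
    also have "\<dots> = \<phi> x + ?a * gauss_tail x"
      by (simp add: set_integral_add set_integrableI_integrable gauss_moments_integrable
        gauss_tail_first_moment gauss_tail_def)
    also have "\<dots> \<le> \<phi> x + ?a * (sqrt (pi / 2) * \<phi> x)"
      using gauss_tail_le[OF x] a by (simp add: mult_left_mono)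
    also have "\<dots> = 2 * \<phi> x" using a(2) by (simp add: mult.assoc[symmetric])
    finally have f: "\<bar>stein_sol h x\<bar> \<le> 2"
      unfolding stein_sol_atLeast[OF int[OF P]] by (simp add: field_simps)
    let ?J = "LINT t:{x..}|lborel. \<phi> t * (h t - h x)"
    let ?d = "\<phi> x - x * gauss_tail x"
    have d: "?d \<ge> 0" using gauss_tail_le_div[of x] by simp
    have "\<bar>?J\<bar> \<le> (LINT t:{x..}|lborel. t * \<phi> t - x * \<phi> t)"
    proof (intro set_integral_abs_le centred_integrable int P Bochner_Integration.integrable_diff
        integrable_mult_right gauss_moments_integrable)
      fix t assume "t \<in> {x..}"
      then have "\<phi> t * \<bar>h t - h x\<bar> \<le> \<phi> t * (t - x)"
        using lip[OF P, of t x] by (intro mult_left_mono) auto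
      then show "\<bar>\<phi> t * (h t - h x)\<bar> \<le> t * \<phi> t - x * \<phi> t"
        unfolding abs_mult by (simp add: right_diff_distrib left_diff_distrib mult.commute)
    qed simp
    also have "\<dots> = ?d"
      by (simp add: set_integral_diff set_integrableI_integrable gauss_moments_integrable
        gauss_tail_first_moment gauss_tail_def)
    finally have J: "\<bar>?J\<bar> \<le> ?d" .
    have "(LINT t:{x..}|lborel. \<phi> t * (h t - ?c)) = (LINT t:{x..}|lborel. \<phi> t * (h t - h x) + (h x - ?c) * \<phi> t)"
      by (simp add: algebra_simps)
    also have "\<dots> = ?J + (h x - ?c) * gauss_tail x"
      using centred_integrable[OF int[OF P], of "h x"]
      by (simp add: set_integral_add set_integrableI_integrable gauss_moments_integrable gauss_tail_def)
    finally have I: "stein_sol h x = - (?J + (h x - ?c) * gauss_tail x) / \<phi> x"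
      by (simp add: stein_sol_atLeast[OF int[OF P]])
    have regroup: "x * - (J + u * q) + p * u = u * (p - x * q) - x * J" for J u q p
      by (simp add: algebra_simps)
    have "\<phi> x * stein_sol h x = - (?J + (h x - ?c) * gauss_tail x)"
      unfolding I using less_imp_neq[OF gauss_pos[of x]] by simp
    then have "\<phi> x * (x * stein_sol h x + h x - ?c) = x * - (?J + (h x - ?c) * gauss_tail x) + \<phi> x * (h x - ?c)"
      by (simp only: right_diff_distrib distrib_left add_diff_eq mult.left_commute[of "\<phi> x" x])
    also have "\<dots> = (h x - ?c) * ?d - x * ?J"
      by (rule regroup)
    also have "\<bar>\<dots>\<bar> \<le> (x + ?a) * ?d + x * ?d"
    proof -
      have "\<bar>(h x - ?c) * ?d\<bar> \<le> (x + ?a) * ?d"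
        unfolding abs_mult using c[OF P, of x] d x by (intro mult_mono) auto
      moreover have "\<bar>x * ?J\<bar> \<le> x * ?d"
        unfolding abs_mult using J x by (simp add: mult_left_mono)
      ultimately show ?thesis by linarith
    qed
    also have "\<dots> = (2 * x + ?a) * ?d" by (simp add: algebra_simps)
    also have "\<dots> \<le> ((1 + ?a) * (1 + x\<^sup>2)) * ?d"
    proof (rule mult_right_mono[OF _ d])
      have "2 * x \<le> 1 + x\<^sup>2" using sum_squares_bound[of 1 x] by simp
      moreover have "0 \<le> x\<^sup>2 * ?a" using a by simp
      moreover have "(1 + ?a) * (1 + x\<^sup>2) = 1 + x\<^sup>2 + ?a + x\<^sup>2 * ?a" by (simp add: algebra_simps)
      ultimately show "2 * x + ?a \<le> (1 + ?a) * (1 + x\<^sup>2)" by linarith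
    qed
    also have "\<dots> \<le> (1 + ?a) * \<phi> x"
    proof -
      have "x * (x * \<phi> x) \<le> x * ((1 + x\<^sup>2) * gauss_tail x)"
        using gauss_tail_ge[of x] x by (rule mult_left_mono)
      then have "(1 + x\<^sup>2) * ?d \<le> \<phi> x" by (simp add: algebra_simps power2_eq_square)
      then show ?thesis using a(1) by (simp add: mult.assoc mult_left_mono)
    qed
    finally have "\<phi> x * \<bar>x * stein_sol h x + h x - ?c\<bar> \<le> \<phi> x * (1 + ?a)"
      by (simp add: abs_mult mult.commute)
    then have "\<bar>x * stein_sol h x + h x - ?c\<bar> \<le> 1 + ?a" by simp
    with f show ?thesis ..
  qed
  have P: "?P h" "?P (\<lambda>t. h (- t))"
    using assms lip[OF assms, of "- s" "- t" for s t] by (auto simp: lipschitz_on_def dist_real_def abs_minus_commute)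
  show "integrable lborel (\<lambda>t. \<phi> t * h t)" by (rule int[OF P(1)])
  show "\<bar>stein_sol h x\<bar> \<le> 2" "\<bar>x * stein_sol h x + h x - gauss_mean h\<bar> \<le> 1 + ?a"
    by (rule stein_sol_bound_reflect[OF * P int[OF P(1)]]; assumption)+
qed

section \<open>Comparison of the walk with the normal distribution\<close>

text \<open>
  One-sided comparison, in which the test function \<open>H\<close> of the walk may be smaller than \<open>h\<close>. Choosing
  \<open>h\<close> as an indicator enlarged by one step makes this hold across its jumps.
\<close>

lemma srw_mean_le_gauss_mean_unit_range:
  fixes h :: "real \<Rightarrow> real"
  assumes n: "n > 0" and \<sigma>: "\<sigma> = 1 / sqrt (real n)"
    and h: "h \<in> borel_measurable borel" "\<And>t. h t \<in> {0..1}"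
    and S: "finite S" "\<And>t. t \<notin> S \<Longrightarrow> isCont h t"
    and H: "\<And>s t. \<bar>of_int s * \<sigma> - t\<bar> \<le> \<sigma> \<Longrightarrow> H s \<le> h t"
  shows "srw_mean n H \<le> gauss_mean h + (2 + sqrt (pi / 2)) * \<sigma> / 2"
proof -
  note bounds = stein_sol_bounds_unit_range[OF h]
  have "srw_mean n H \<le> gauss_mean h + (2 + sqrt (pi / 2) + 0) * \<sigma> / 2"
    by (rule srw_mean_le_stein[where f = "stein_sol h" and h = h and L = 0])
      (use n \<sigma> H bounds stein_sol_equation[OF bounds(1) S] in auto)
  then show ?thesis by simp
qed

lemma srw_mean_ge_gauss_mean_unit_range:
  fixes h :: "real \<Rightarrow> real"
  assumes n: "n > 0" and \<sigma>: "\<sigma> = 1 / sqrt (real n)"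
    and h: "h \<in> borel_measurable borel" "\<And>t. h t \<in> {0..1}"
    and S: "finite S" "\<And>t. t \<notin> S \<Longrightarrow> isCont h t"
    and H: "\<And>s t. \<bar>of_int s * \<sigma> - t\<bar> \<le> \<sigma> \<Longrightarrow> h t \<le> H s"
  shows "gauss_mean h \<le> srw_mean n H + (2 + sqrt (pi / 2)) * \<sigma> / 2"
proof -
  have "srw_mean n (\<lambda>s. 1 - H s) \<le> gauss_mean (\<lambda>t. 1 - h t) + (2 + sqrt (pi / 2)) * \<sigma> / 2"
    using h by (intro srw_mean_le_gauss_mean_unit_range[OF n \<sigma> _ _ S(1)] continuous_intros S(2)) (auto simp: H)
  also have "gauss_mean (\<lambda>t. 1 - h t) = 1 - gauss_mean h"
    using stein_sol_bounds_unit_range(1)[OF h] gauss_moments_integrable(1)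
    by (simp add: gauss_mean_def right_diff_distrib gauss_integral)
  finally show ?thesis by (simp add: srw_mean_diff srw_mean_const)
qed

text \<open>
  The error \<open>\<kappa>\<close> leaves room for the difference between the folded walk and the absolute value.
\<close>

lemma srw_mean_gauss_mean_lipschitz:
  assumes n: "n > 0" and \<sigma>: "\<sigma> = 1 / sqrt (real n)"
    and h: "1-lipschitz_on UNIV h" and H: "\<And>s. \<bar>H s - h (of_int s * \<sigma>)\<bar> \<le> \<kappa>"
  shows "\<bar>srw_mean n H - gauss_mean h\<bar> \<le> \<kappa> + (4 + sqrt (2 / pi)) * \<sigma> / 2"
proof -
  have *: "srw_mean n H - gauss_mean h \<le> \<kappa> + (4 + sqrt (2 / pi)) * \<sigma> / 2"
    if h: "1-lipschitz_on UNIV h" and H: "\<And>s. \<bar>H s - h (of_int s * \<sigma>)\<bar> \<le> \<kappa>" for h H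
  proof -
    note bounds = stein_sol_bounds_lipschitz[OF h]
    have cont: "isCont h t" for t
      using lipschitz_on_continuous_on[OF h] by (simp add: continuous_on_eq_continuous_at)
    have "H s - \<kappa> \<le> h t + 1 * \<bar>of_int s * \<sigma> - t\<bar>" for s t
      using lipschitz_onD[OF h, of "of_int s * \<sigma>" t] H[of s] by (simp add: dist_real_def)
    then have "srw_mean n (\<lambda>s. H s - \<kappa>) \<le> gauss_mean h + ((1 + sqrt (2 / pi)) + 2 + 1) * \<sigma> / 2"
      by (intro srw_mean_le_stein[where f = "stein_sol h" and h = h, OF n \<sigma> stein_sol_equation[OF bounds(1), of "{}"] bounds(3,2)])
        (auto simp: cont)
    then show ?thesis by (simp add: srw_mean_diff srw_mean_const algebra_simps)
  qed
  have "1-lipschitz_on UNIV (\<lambda>t. - h t)"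
    using h by (simp add: lipschitz_on_def dist_minus)
  from *[OF this, of "\<lambda>s. - H s"] H
  have "srw_mean n (\<lambda>s. - H s) - gauss_mean (\<lambda>t. - h t) \<le> \<kappa> + (4 + sqrt (2 / pi)) * \<sigma> / 2"
    by (simp add: abs_minus_commute)
  moreover have "srw_mean n (\<lambda>s. - H s) = - srw_mean n H"
    using srw_mean_cmult[of n "-1" H] by simp
  ultimately show ?thesis
    using *[OF h H] by (simp add: gauss_mean_def abs_le_iff)
qed

text \<open>
  Enlarging the interval adds two pieces of length \<open>d\<close>, on which the density is at most
  \<open>\<phi>(0) = \<surd>(2/\<pi>)/2\<close>. For negative \<open>z\<close> the smaller interval is empty and the bound still holds.
\<close>

lemma gauss_mean_symmetric_interval_le:
  assumes "d \<ge> 0"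
  shows "gauss_mean (indicator {-(z + d)..z + d}) \<le> gauss_mean (indicator {- z..z}) + d * sqrt (2 / pi)"
proof -
  let ?a = "sqrt (2 / pi)"
  have int: "integrable lborel (\<lambda>t. \<phi> t * indicator A t)" if "A \<in> sets borel" for A :: "real set"
    using integrable_mult_indicator[of A lborel \<phi>] that gauss_moments_integrable(1)
    by (simp add: mult.commute)
  have "gauss_mean (indicator {-(z + d)..z + d})
      \<le> (\<integral>t. \<phi> t * indicator {- z..z} t + ?a / 2 * (indicator {z..z + d} t + indicator {-(z + d)..- z} t) \<partial>lborel)"
    unfolding gauss_mean_def
  proof (intro integral_mono int Bochner_Integration.integrable_add integrable_mult_right integrable_real_indicator)
    fix t :: real
    show "\<phi> t * indicator {-(z + d)..z + d} t
      \<le> \<phi> t * indicator {- z..z} t + ?a / 2 * (indicator {z..z + d} t + indicator {-(z + d)..- z} t)"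
      using gauss_le[of t] gauss_pos[of t] assms by (auto simp: indicator_def)
  qed (auto simp: emeasure_lborel_Icc_eq)
  also have "\<dots> = gauss_mean (indicator {- z..z}) + d * ?a"
    using assms by (simp add: gauss_mean_def int)
  finally show ?thesis .
qed

lemma isCont_indicator_Icc:
  fixes t :: real
  assumes "t \<notin> {a, b}"
  shows "isCont (indicator {a..b} :: real \<Rightarrow> real) t"
  using assms by (auto simp: isCont_indicator frontier_def)

lemma fold_mirror_bounds:
  "\<bar>real_of_int s\<bar> - 1 \<le> of_int (fold_mirror s)" "of_int (fold_mirror s) \<le> \<bar>real_of_int s\<bar>"
  by (auto simp: fold_mirror_def)

lemma wasserstein_constant: "sqrt (2 / pi) / 2 \<le> 2 / pi"
proof -
  have "1 / 2 \<le> sqrt (2 / pi)"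
    using pi_less_4 by (intro real_le_rsqrt) (simp add: power2_eq_square field_simps)
  then have "sqrt (2 / pi) * (1 / 2) \<le> sqrt (2 / pi) * sqrt (2 / pi)"
    by (intro mult_left_mono) auto
  then show ?thesis by simp
qed

lemma kolmogorov_constant: "2 * sqrt (2 / pi) + (2 + sqrt (pi / 2)) / 2 \<le> 4 * sqrt (2 / pi) + 1 / 2"
proof -
  have "7 / 10 \<le> sqrt (2 / pi)"
    using pi_less_4 by (intro real_le_rsqrt) (simp add: power2_eq_square field_simps)
  moreover have "sqrt (pi / 2) \<le> 3 / 2"
    using pi_less_4 by (intro real_le_lsqrt) (simp_all add: power2_eq_square field_simps)
  ultimately show ?thesis by simp
qed

theorem theorem1p2:
  fixes M :: "'a measure" and X :: "nat \<Rightarrow> 'a \<Rightarrow> real"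
    and N :: "'b measure" and Z :: "'b \<Rightarrow> real"
    and n m :: nat
  assumes "prob_space M" and "symmetric_steps M X"
    and "prob_space N" and "distributed N lborel Z std_normal_density"
    and "n = 2 * m" and "n > 0"
  shows "let W = (\<lambda>\<omega>. walk_max X n \<omega> / sqrt (real n)); Y = (\<lambda>\<omega>. \<bar>Z \<omega>\<bar>) in
           wasserstein_dist M W N Y \<le> ereal (1 / sqrt (real n) * (3 + 2 / pi)) \<and>
           kolmogorov_dist M W N Y
             \<le> ereal (1 / sqrt (real n) * (4 * sqrt (2 / pi) + 1 / 2) + 2 / real n)"
proof -
  interpret M: prob_space M by fact
  interpret N: prob_space N by fact
  note n = \<open>n > 0\<close>
  define \<sigma> where "\<sigma> = 1 / sqrt (real n)"
  have \<sigma>0: "\<sigma> > 0" using n by (simp add: \<sigma>_def)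
  let ?R = "\<lambda>s. of_int (fold_mirror s) * \<sigma>"
  have EM: "M.expectation (\<lambda>\<omega>. g (walk_max X n \<omega> * \<sigma>)) = srw_mean n (\<lambda>s. g (?R s))"
    if [measurable]: "g \<in> borel_measurable borel" for g
    using M.expectation_walk_max[OF assms(2), of "\<lambda>x. g (x * \<sigma>)" n] by simp
  have EN: "N.expectation (\<lambda>\<omega>. g (Z \<omega>)) = gauss_mean g"
    if "g \<in> borel_measurable borel" for g
    using distributed_integral[OF assms(4), of g] that by (simp add: gauss_mean_def)
  have Z [measurable]: "Z \<in> borel_measurable N"
    using distributed_measurable[OF assms(4)] by simp
  have rv [measurable]: "walk_max X n \<in> borel_measurable M"
    by (rule walk_max_measurable) (rule M.symmetric_steps_prob(1)[OF assms(2)])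

  have wass: "\<bar>M.expectation (\<lambda>\<omega>. h (walk_max X n \<omega> * \<sigma>)) - N.expectation (\<lambda>\<omega>. h \<bar>Z \<omega>\<bar>)\<bar>
      \<le> \<sigma> * (3 + 2 / pi)" if h: "1-lipschitz_on UNIV h" for h
  proof -
    have lip: "\<bar>h x - h y\<bar> \<le> \<bar>x - y\<bar>" for x y
      using lipschitz_onD[OF h, of x y] by (simp add: dist_real_def)
    have [measurable]: "h \<in> borel_measurable borel"
      by (intro borel_measurable_continuous_onI lipschitz_on_continuous_on[OF h])
    have habs: "1-lipschitz_on UNIV (\<lambda>t. h \<bar>t\<bar>)"
      by (rule lipschitz_onI) (auto simp: dist_real_def intro: order_trans[OF lip])
    have "\<bar>h (?R s) - h \<bar>of_int s * \<sigma>\<bar>\<bar> \<le> \<sigma>" for s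
    proof -
      have "\<bar>?R s - \<bar>of_int s * \<sigma>\<bar>\<bar> = \<bar>of_int (fold_mirror s) - \<bar>of_int s\<bar>\<bar> * \<sigma>"
      proof -
        have "\<bar>of_int s * \<sigma>\<bar> = \<bar>of_int s\<bar> * \<sigma>" using \<sigma>0 by (simp add: abs_mult)
        then have "?R s - \<bar>of_int s * \<sigma>\<bar> = (of_int (fold_mirror s) - \<bar>of_int s\<bar>) * \<sigma>"
          by (simp only: left_diff_distrib)
        then show ?thesis using \<sigma>0 by (simp add: abs_mult)
      qed
      also have "\<dots> \<le> 1 * \<sigma>"
        using fold_mirror_bounds[of s] \<sigma>0 by (intro mult_right_mono) auto
      finally show ?thesis using lip[of "?R s" "\<bar>of_int s * \<sigma>\<bar>"] by simp
    qed
    from srw_mean_gauss_mean_lipschitz[OF n \<sigma>_def habs this]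
    have "\<bar>srw_mean n (\<lambda>s. h (?R s)) - gauss_mean (\<lambda>t. h \<bar>t\<bar>)\<bar> \<le> \<sigma> * (3 + sqrt (2 / pi) / 2)"
      by (simp add: algebra_simps add_divide_distrib)
    also have "\<dots> \<le> \<sigma> * (3 + 2 / pi)"
      using wasserstein_constant \<sigma>0 by (intro mult_left_mono) auto
    finally show ?thesis by (simp add: EM EN[of "\<lambda>t. h \<bar>t\<bar>"])
  qed

  have kolm: "\<bar>\<P>(\<omega> in M. walk_max X n \<omega> * \<sigma> \<le> z) - \<P>(\<omega> in N. \<bar>Z \<omega>\<bar> \<le> z)\<bar>
      \<le> \<sigma> * (4 * sqrt (2 / pi) + 1 / 2)" for z
  proof -
    let ?e = "(2 + sqrt (pi / 2)) * \<sigma> / 2"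
    let ?H = "\<lambda>s. indicator {..z} (?R s) :: real"
    have "M.expectation (\<lambda>\<omega>. indicator {..z} (walk_max X n \<omega> * \<sigma>))
        = M.expectation (indicator {\<omega> \<in> space M. walk_max X n \<omega> * \<sigma> \<le> z})"
      by (intro Bochner_Integration.integral_cong) (auto simp: indicator_def)
    also have "\<dots> = \<P>(\<omega> in M. walk_max X n \<omega> * \<sigma> \<le> z)" by simp
    finally have PM: "\<P>(\<omega> in M. walk_max X n \<omega> * \<sigma> \<le> z) = srw_mean n ?H"
      by (subst (asm) EM) auto
    have "N.expectation (\<lambda>\<omega>. indicator {- z..z} (Z \<omega>)) = N.expectation (indicator {\<omega> \<in> space N. \<bar>Z \<omega>\<bar> \<le> z})"
      by (intro Bochner_Integration.integral_cong) (auto simp: indicator_def)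
    also have "\<dots> = \<P>(\<omega> in N. \<bar>Z \<omega>\<bar> \<le> z)" by simp
    finally have PN: "\<P>(\<omega> in N. \<bar>Z \<omega>\<bar> \<le> z) = gauss_mean (indicator {- z..z})"
      by (subst (asm) EN) auto
    have R: "\<bar>of_int s * \<sigma>\<bar> - \<sigma> \<le> ?R s" "?R s \<le> \<bar>of_int s * \<sigma>\<bar>" for s
      using mult_right_mono[OF fold_mirror_bounds(1)[of s], of \<sigma>] mult_right_mono[OF fold_mirror_bounds(2)[of s], of \<sigma>] \<sigma>0
      by (simp_all add: abs_mult algebra_simps)
    \<comment> \<open>The upper bound enlarges the interval by \<open>2 \<sigma>\<close>: one \<open>\<sigma>\<close> for folding, one for the lattice step.
      The lower bound needs only the latter, since folding never increases \<open>\<bar>s\<bar>\<close>.\<close>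
    have "srw_mean n ?H \<le> gauss_mean (indicator {-(z + 2 * \<sigma>)..z + 2 * \<sigma>}) + ?e"
    proof (rule srw_mean_le_gauss_mean_unit_range[OF n \<sigma>_def, where S = "{-(z + 2 * \<sigma>), z + 2 * \<sigma>}"])
      fix s t assume "\<bar>of_int s * \<sigma> - t\<bar> \<le> \<sigma>"
      with R[of s] show "?H s \<le> indicator {-(z + 2 * \<sigma>)..z + 2 * \<sigma>} t"
        by (auto simp: indicator_def)
    qed (auto intro: isCont_indicator_Icc simp: indicator_def)
    also have "gauss_mean (indicator {-(z + 2 * \<sigma>)..z + 2 * \<sigma>}) \<le> gauss_mean (indicator {- z..z}) + 2 * \<sigma> * sqrt (2 / pi)"
      using \<sigma>0 by (intro gauss_mean_symmetric_interval_le) simp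
    finally have up: "srw_mean n ?H - gauss_mean (indicator {- z..z}) \<le> 2 * \<sigma> * sqrt (2 / pi) + ?e"
      by simp
    have nonneg: "0 \<le> \<sigma> * sqrt (2 / pi)" using \<sigma>0 by simp
    have "gauss_mean (indicator {- z..z}) \<le> gauss_mean (indicator {-(z - \<sigma>)..z - \<sigma>}) + \<sigma> * sqrt (2 / pi)"
      using gauss_mean_symmetric_interval_le[of \<sigma> "z - \<sigma>"] \<sigma>0 by simp
    also have "gauss_mean (indicator {-(z - \<sigma>)..z - \<sigma>}) \<le> srw_mean n ?H + ?e"
    proof (rule srw_mean_ge_gauss_mean_unit_range[OF n \<sigma>_def, where S = "{-(z - \<sigma>), z - \<sigma>}"])
      fix s t assume "\<bar>of_int s * \<sigma> - t\<bar> \<le> \<sigma>"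
      with R[of s] show "indicator {-(z - \<sigma>)..z - \<sigma>} t \<le> ?H s"
        by (auto simp: indicator_def)
    qed (auto intro: isCont_indicator_Icc simp: indicator_def)
    finally have "gauss_mean (indicator {- z..z}) - srw_mean n ?H \<le> 2 * \<sigma> * sqrt (2 / pi) + ?e"
      using nonneg by linarith
    with up have "\<bar>srw_mean n ?H - gauss_mean (indicator {- z..z})\<bar> \<le> 2 * \<sigma> * sqrt (2 / pi) + ?e"
      by simp
    also have "\<dots> = \<sigma> * (2 * sqrt (2 / pi) + (2 + sqrt (pi / 2)) / 2)" by (simp add: algebra_simps)
    also have "\<dots> \<le> \<sigma> * (4 * sqrt (2 / pi) + 1 / 2)"
      using \<sigma>0 kolmogorov_constant by (intro mult_left_mono) auto
    finally show ?thesis unfolding PM PN .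
  qed

  have W: "walk_max X n \<omega> / sqrt (real n) = walk_max X n \<omega> * \<sigma>" for \<omega>
    by (simp add: \<sigma>_def)
  have "wasserstein_dist M (\<lambda>\<omega>. walk_max X n \<omega> / sqrt (real n)) N (\<lambda>\<omega>. \<bar>Z \<omega>\<bar>) \<le> ereal (\<sigma> * (3 + 2 / pi))"
    unfolding wasserstein_dist_def W by (intro SUP_least) (simp add: wass)
  moreover have "kolmogorov_dist M (\<lambda>\<omega>. walk_max X n \<omega> / sqrt (real n)) N (\<lambda>\<omega>. \<bar>Z \<omega>\<bar>)
      \<le> ereal (\<sigma> * (4 * sqrt (2 / pi) + 1 / 2) + 2 / real n)"
    unfolding kolmogorov_dist_def W
    by (intro SUP_least) (simp add: order_trans[OF kolm])
  ultimately show ?thesis by (simp add: Let_def \<sigma>_def)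
qed

end
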